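(* Let $n$ be a positive integer, let $\mathbb{F}$ be a field, and let $0\leq k<n$ be integers. Let $f\in I(\mathcal{V}(n,k))\subseteq \mathbb{F}[x_1,\ldots,x_n]$, and suppose that there exists a vector $\mathbf{v}\in\{0,1\}^n\setminus \mathcal{V}(n,k)$ such that $f(\mathbf{v})\neq 0$. Then $\deg(f)>k$.
   Context: Write $[n]=\{1,\ldots,n\}$. For $K\subseteq [n]$, $\mathbf{v}_K\in\{0,1\}^n\subseteq\mathbb{F}^n$ denotes the characteristic vector of $K$. For integers $0\le k<n$, $\mathcal{V}(n,k):=\{\mathbf{v}_K : K\subseteq [n],\ |K|\leq k\}\subseteq\{0,1\}^n\subseteq\mathbb{F}^n$. For a set of points $\mathcal{W}\subseteq\mathbb{F}^n$, $I(\mathcal{W})$ is the vanishing ideal $\{f\in\mathbb{F}[x_1,\ldots,x_n] : f(\mathbf{v})=0 \text{ for all } \mathbf{v}\in\mathcal{W}\}$. The degree $\deg$ is the total degree. *)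

theory Defs
  imports Main "HOL-Library.FuncSet" "HOL-Library.Poly_Mapping"
begin

text \<open>
  A polynomial is a finitely supported map from monomials to coefficients, and a monomial a
  finitely supported map from variable indices to exponents; the ring operations are those of
  \<^theory>\<open>HOL-Library.Poly_Mapping\<close>. The variables \<open>x\<^sub>1, \<dots>, x\<^sub>n\<close> have the indices \<open>1, \<dots>, n\<close>.
\<close>

type_synonym monomial = "nat \<Rightarrow>\<^sub>0 nat"

type_synonym 'a mpoly = "monomial \<Rightarrow>\<^sub>0 'a"

definition polynomials :: "nat \<Rightarrow> 'a::field mpoly set" where
  "polynomials n = {f. \<forall>m\<in>Poly_Mapping.keys f. Poly_Mapping.keys m \<subseteq> {1..n}}"

definition eval_monomial :: "(nat \<Rightarrow> 'a) \<Rightarrow> monomial \<Rightarrow> 'a::field" where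
  "eval_monomial v m = (\<Prod>i\<in>Poly_Mapping.keys m. v i ^ Poly_Mapping.lookup m i)"

definition eval_poly :: "(nat \<Rightarrow> 'a) \<Rightarrow> 'a mpoly \<Rightarrow> 'a::field" where
  "eval_poly v f = (\<Sum>m\<in>Poly_Mapping.keys f. Poly_Mapping.lookup f m * eval_monomial v m)"

definition monomial_degree :: "monomial \<Rightarrow> nat" where
  "monomial_degree m = (\<Sum>i\<in>Poly_Mapping.keys m. Poly_Mapping.lookup m i)"

text \<open>The inserted \<open>0\<close> only matters for the zero polynomial, which gets degree \<open>0\<close>.\<close>

definition total_degree :: "'a::field mpoly \<Rightarrow> nat" where
  "total_degree f = Max (insert 0 (monomial_degree ` Poly_Mapping.keys f))"

text \<open>
  Points of the affine \<open>n\<close>-space over the field are represented as extensional functions on \<open>{1..n}\<close>, so that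
  distinct functions are distinct points.
\<close>

definition hypercube :: "nat \<Rightarrow> (nat \<Rightarrow> 'a::field) set" where
  "hypercube n = {1..n} \<rightarrow>\<^sub>E {0, 1}"

definition char_vec :: "nat \<Rightarrow> nat set \<Rightarrow> nat \<Rightarrow> 'a::field" where
  "char_vec n K = (\<lambda>i\<in>{1..n}. if i \<in> K then 1 else 0)"

definition low_weight_vecs :: "nat \<Rightarrow> nat \<Rightarrow> (nat \<Rightarrow> 'a::field) set" where
  "low_weight_vecs n k = {char_vec n K | K. K \<subseteq> {1..n} \<and> card K \<le> k}"

definition vanishing_ideal :: "nat \<Rightarrow> (nat \<Rightarrow> 'a) set \<Rightarrow> 'a::field mpoly set" where
  "vanishing_ideal n W = {f \<in> polynomials n. \<forall>v\<in>W. eval_poly v f = 0}"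

lemma low_weight_vecs_subset_hypercube: "low_weight_vecs n k \<subseteq> hypercube n"
  by (auto simp: low_weight_vecs_def hypercube_def char_vec_def split: if_splits)

end

theory Submission imports Defs begin

text \<open>
  On the hypercube every monomial equals the product of the variables in its support. Grouping the
  coefficients of \<open>f\<close> by support gives sums \<open>c S\<close> with \<open>f(v\<^sub>K) = (\<Sum>S\<subseteq>K. c S)\<close>. If \<open>f\<close> vanishes on all
  \<open>v\<^sub>K\<close> with \<open>card K \<le> k\<close>, then inductively \<open>c S = 0\<close> whenever \<open>card S \<le> k\<close>; if moreover \<open>deg f \<le> k\<close>,
  then no support has more than \<open>k\<close> elements, so all \<open>c S\<close> vanish, and \<open>f\<close> is zero on the whole hypercube.
\<close>

text \<open>These are the coefficients of the multilinear reduction of \<open>f\<close> modulo all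
  \<open>x_i^2 - x_i\<close>, indexed by sets of variables.\<close>

definition support_coeff :: "'a::field mpoly \<Rightarrow> nat set \<Rightarrow> 'a" where
  "support_coeff f S =
    (\<Sum>m | m \<in> Poly_Mapping.keys f \<and> Poly_Mapping.keys m = S. Poly_Mapping.lookup f m)"

lemma hypercube_char_vec:
  assumes "v \<in> hypercube n"
  obtains K where "K \<subseteq> {1..n}" "v = char_vec n K"
proof
  show "{i \<in> {1..n}. v i = 1} \<subseteq> {1..n}" by auto
  show "v = char_vec n {i \<in> {1..n}. v i = 1}"
  proof
    fix i
    \<comment> \<open>Outside \<open>{1..n}\<close> both sides are \<open>undefined\<close>, by
      extensionality.\<close>
    show "v i = char_vec n {i \<in> {1..n}. v i = 1} i"
      using assms PiE_arb[of v "{1..n}" "\<lambda>_. {0, 1}" i] PiE_mem[of v "{1..n}" "\<lambda>_. {0, 1}" i]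
      by (cases "i \<in> {1..n}") (auto simp: hypercube_def char_vec_def)
  qed
qed

lemma eval_monomial_char_vec:
  assumes "Poly_Mapping.keys m \<subseteq> {1..n}"
  shows "eval_monomial (char_vec n K) m = (if Poly_Mapping.keys m \<subseteq> K then 1 else (0::'a::field))"
proof (cases "Poly_Mapping.keys m \<subseteq> K")
  case True
  with assms have "char_vec n K i = (1::'a)" if "i \<in> Poly_Mapping.keys m" for i
    using that by (auto simp: char_vec_def)
  with True show ?thesis by (simp add: eval_monomial_def)
next
  case False
  then obtain i where i: "i \<in> Poly_Mapping.keys m" "i \<notin> K" by auto
  with assms have "char_vec n K i = (0::'a)" by (auto simp: char_vec_def)
  \<comment> \<open>A positive exponent is essential here, as \<open>0 ^ 0 = 1\<close>.\<close>
  moreover have "Poly_Mapping.lookup m i > 0"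
    using i by (simp add: in_keys_iff)
  ultimately have "(char_vec n K i :: 'a) ^ Poly_Mapping.lookup m i = 0" by simp
  with i(1) have "eval_monomial (char_vec n K) m = (0::'a)"
    unfolding eval_monomial_def by (intro prod_zero) auto
  with False show ?thesis by simp
qed

lemma eval_poly_char_vec:
  assumes f: "f \<in> polynomials n" and K: "K \<subseteq> {1..n}"
  shows "eval_poly (char_vec n K) f = (\<Sum>S\<in>Pow K. support_coeff f S)"
proof -
  let ?M = "{m \<in> Poly_Mapping.keys f. Poly_Mapping.keys m \<subseteq> K}"
  have fin: "finite K" using K finite_subset by blast
  have "eval_poly (char_vec n K) f =
      (\<Sum>m\<in>Poly_Mapping.keys f. if Poly_Mapping.keys m \<subseteq> K then Poly_Mapping.lookup f m else 0)"
    unfolding eval_poly_def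
    using f by (intro sum.cong) (auto simp: polynomials_def eval_monomial_char_vec)
  also have "\<dots> = (\<Sum>m\<in>?M. Poly_Mapping.lookup f m)"
    by (simp add: sum.inter_filter)
  also have "\<dots> = (\<Sum>S\<in>Pow K. \<Sum>m | m \<in> ?M \<and> Poly_Mapping.keys m = S. Poly_Mapping.lookup f m)"
    using fin by (intro sum.group[symmetric]) auto
  \<comment> \<open>For \<open>S \<subseteq> K\<close>, support equal to \<open>S\<close> already
    forces membership in \<open>?M\<close>.\<close>
  also have "\<dots> = (\<Sum>S\<in>Pow K. support_coeff f S)"
    unfolding support_coeff_def by (intro sum.cong refl) auto
  finally show ?thesis .
qed

text \<open>Each variable in the support of a monomial has exponent at least 1, so it contributes at
  least 1 to the degree.\<close>

lemma card_keys_le_total_degree: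
  assumes "m \<in> Poly_Mapping.keys f"
  shows "card (Poly_Mapping.keys m) \<le> total_degree f"
proof -
  have "card (Poly_Mapping.keys m) = (\<Sum>i\<in>Poly_Mapping.keys m. 1)" by simp
  also have "\<dots> \<le> monomial_degree m"
    unfolding monomial_degree_def by (intro sum_mono) (auto simp: in_keys_iff Suc_le_eq)
  also have "\<dots> \<le> total_degree f"
    unfolding total_degree_def using assms by (intro Max_ge) auto
  finally show ?thesis .
qed

lemma support_coeff_eq_0_if_total_degree_less:
  assumes "total_degree f < card S"
  shows "support_coeff f S = 0"
proof -
  have "{m \<in> Poly_Mapping.keys f. Poly_Mapping.keys m = S} = {}"
    using assms card_keys_le_total_degree by fastforce
  then show ?thesis unfolding support_coeff_def by (simp only: sum.empty)
qed

lemma support_coeff_eq_0_if_vanishing: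
  assumes f: "f \<in> vanishing_ideal n (low_weight_vecs n k)"
    and "S \<subseteq> {1..n}" "card S \<le> k"
  shows "support_coeff f S = 0"
proof -
  have "finite S" using assms(2) finite_subset by blast
  then show ?thesis using assms(2,3)
  proof (induction S rule: finite_psubset_induct)
    case (psubset S)
    have "support_coeff f T = 0" if "T \<subset> S" for T
      using that psubset by (metis less_imp_le order_trans psubset_card_mono)
    \<comment> \<open>By the induction hypothesis only the term \<open>T = S\<close> survives, so
      the value of \<open>f\<close> at the vector of \<open>S\<close> isolates
      \<open>support_coeff f S\<close>.\<close>
    then have "(\<Sum>T\<in>Pow S. support_coeff f T) = support_coeff f S"
      using psubset.hyps by (subst sum.remove[of _ S]) (auto intro!: sum.neutral)
    moreover have "eval_poly (char_vec n S) f = 0"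
      using f psubset.prems by (auto simp: vanishing_ideal_def low_weight_vecs_def)
    moreover have "f \<in> polynomials n"
      using f by (simp add: vanishing_ideal_def)
    ultimately show ?case
      using eval_poly_char_vec psubset.prems(1) by metis
  qed
qed

theorem theorem1p4:
  fixes n k :: nat and f :: "'a::field mpoly"
  assumes "n > 0"
    and "k < n"
    and "f \<in> vanishing_ideal n (low_weight_vecs n k)"
    and "\<exists>v \<in> hypercube n - low_weight_vecs n k. eval_poly v f \<noteq> 0"
  shows "total_degree f > k"
proof (rule ccontr)
  assume "\<not> total_degree f > k"
  \<comment> \<open>Split at \<open>card S \<le> k\<close>: vanishing handles the small sets, and
    larger ones exceed \<open>total_degree f \<le> k\<close>.\<close>
  then have c: "support_coeff f S = 0" if "S \<subseteq> {1..n}" for S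
    using that assms(3) support_coeff_eq_0_if_vanishing support_coeff_eq_0_if_total_degree_less
    by (metis le_less_trans not_less)
  obtain v where v: "v \<in> hypercube n" "eval_poly v f \<noteq> 0" using assms(4) by auto
  obtain K where K: "K \<subseteq> {1..n}" "v = char_vec n K" using v(1) by (rule hypercube_char_vec)
  have "f \<in> polynomials n" using assms(3) by (simp add: vanishing_ideal_def)
  then have "eval_poly v f = (\<Sum>S\<in>Pow K. support_coeff f S)"
    using K by (simp add: eval_poly_char_vec)
  also have "\<dots> = 0" using K c by (intro sum.neutral) auto
  finally show False using v(2) by simp
qed

end
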